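(* Let $(A,\phi,\gamma)$ be a monoid with a pseudo action of a monoid $M$. Then the map $$\sigma:\mathsf{Groth}(A,\phi,\gamma)\to M,\qquad\sigma(m,a)=m,$$ is a fibration.
   Context: A lax action of a monoid $M$ on a monoid $A$ is given by maps $\phi:A\times M\to A$, $(a,m)\mapsto\phi_m(a)$, and $\gamma:M\times M\to A$, $(m,n)\mapsto\gamma_{m,n}$, such that for all $a,b\in A$ and $m,n,k\in M$: (i) $\phi_1(a)=a$; (ii) $\gamma_{m,n}\phi_n(\phi_m(a))=\phi_{mn}(a)\gamma_{m,n}$; (iii) $\gamma_{mn,k}\phi_k(\gamma_{m,n})=\gamma_{m,nk}\gamma_{n,k}$; (iv) $\gamma_{1,m}=1=\gamma_{m,1}$; (v) $\phi_m(1)=1$ and $\phi_m(ab)=\phi_m(a)\phi_m(b)$. It is a pseudo action if every $\gamma_{m,n}$ is invertible in $A$. $\mathsf{Groth}(A,\phi,\gamma)$ is the monoid with underlying set $M\times A$ and multiplication $(m,a)(n,b)=(mn,\gamma_{m,n}\phi_n(a)b)$, with identity $(1,1)$. For a monoid homomorphism $\sigma:E\to M$, an element $x\in E$ is $\sigma$-cartesian if (i) for every $z\in E$ and $v\in M$ with $\sigma(z)=\sigma(x)v$ there is $y\in E$ with $z=xy$ and $\sigma(y)=v$; and (ii) whenever $y_1,y_2\in E$ satisfy $xy_1=xy_2$ and $\sigma(y_1)=\sigma(y_2)$, then $y_1=y_2$. $\sigma$ is a fibration if above every element of $M$ there is a $\sigma$-cartesian element. *)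

theory Defs
  imports "HOL-Algebra.Group"
begin

text \<open>
  We write \<open>\<phi> m a\<close> for $\phi_m(a)$ and \<open>\<gamma> m n\<close> for $\gamma_{m,n}$; the laws and typings are
  only required on the carriers.
\<close>

locale lax_action = M: monoid M + A: monoid A
  for M :: "('m, 'x) monoid_scheme" (structure)
    and A :: "('a, 'y) monoid_scheme" (structure) +
  fixes \<phi> :: "'m \<Rightarrow> 'a \<Rightarrow> 'a"
    and \<gamma> :: "'m \<Rightarrow> 'm \<Rightarrow> 'a"
  assumes phi_closed: "\<lbrakk>m \<in> carrier M; a \<in> carrier A\<rbrakk> \<Longrightarrow> \<phi> m a \<in> carrier A"
    and gamma_closed: "\<lbrakk>m \<in> carrier M; n \<in> carrier M\<rbrakk> \<Longrightarrow> \<gamma> m n \<in> carrier A"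
    and phi_one_left: "a \<in> carrier A \<Longrightarrow> \<phi> \<one>\<^bsub>M\<^esub> a = a"
    and gamma_phi:
      "\<lbrakk>a \<in> carrier A; m \<in> carrier M; n \<in> carrier M\<rbrakk>
        \<Longrightarrow> \<gamma> m n \<otimes>\<^bsub>A\<^esub> \<phi> n (\<phi> m a) = \<phi> (m \<otimes>\<^bsub>M\<^esub> n) a \<otimes>\<^bsub>A\<^esub> \<gamma> m n"
    and gamma_cocycle:
      "\<lbrakk>m \<in> carrier M; n \<in> carrier M; k \<in> carrier M\<rbrakk>
        \<Longrightarrow> \<gamma> (m \<otimes>\<^bsub>M\<^esub> n) k \<otimes>\<^bsub>A\<^esub> \<phi> k (\<gamma> m n) = \<gamma> m (n \<otimes>\<^bsub>M\<^esub> k) \<otimes>\<^bsub>A\<^esub> \<gamma> n k"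
    and gamma_one_left: "m \<in> carrier M \<Longrightarrow> \<gamma> \<one>\<^bsub>M\<^esub> m = \<one>\<^bsub>A\<^esub>"
    and gamma_one_right: "m \<in> carrier M \<Longrightarrow> \<gamma> m \<one>\<^bsub>M\<^esub> = \<one>\<^bsub>A\<^esub>"
    and phi_one: "m \<in> carrier M \<Longrightarrow> \<phi> m \<one>\<^bsub>A\<^esub> = \<one>\<^bsub>A\<^esub>"
    and phi_mult:
      "\<lbrakk>m \<in> carrier M; a \<in> carrier A; b \<in> carrier A\<rbrakk>
        \<Longrightarrow> \<phi> m (a \<otimes>\<^bsub>A\<^esub> b) = \<phi> m a \<otimes>\<^bsub>A\<^esub> \<phi> m b"

locale pseudo_action = lax_action +
  assumes gamma_Units: "\<lbrakk>m \<in> carrier M; n \<in> carrier M\<rbrakk> \<Longrightarrow> \<gamma> m n \<in> Units A"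

definition Groth ::
  "('m, 'x) monoid_scheme \<Rightarrow> ('a, 'y) monoid_scheme \<Rightarrow> ('m \<Rightarrow> 'a \<Rightarrow> 'a)
    \<Rightarrow> ('m \<Rightarrow> 'm \<Rightarrow> 'a) \<Rightarrow> ('m \<times> 'a) monoid"
  where "Groth M A \<phi> \<gamma> =
    \<lparr>carrier = carrier M \<times> carrier A,
     monoid.mult = (\<lambda>(m, a) (n, b). (m \<otimes>\<^bsub>M\<^esub> n, \<gamma> m n \<otimes>\<^bsub>A\<^esub> \<phi> n a \<otimes>\<^bsub>A\<^esub> b)),
     one = (\<one>\<^bsub>M\<^esub>, \<one>\<^bsub>A\<^esub>)\<rparr>"

text \<open>
  The library's \<^const>\<open>hom\<close> does not include preservation of the unit, which is not automatic for
  monoids.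
\<close>

locale monoid_homomorphism = E: monoid E + M: monoid M
  for E :: "('e, 'x) monoid_scheme" (structure)
    and M :: "('m, 'y) monoid_scheme" (structure) +
  fixes \<sigma> :: "'e \<Rightarrow> 'm"
  assumes hom: "\<sigma> \<in> hom E M"
    and map_one: "\<sigma> \<one>\<^bsub>E\<^esub> = \<one>\<^bsub>M\<^esub>"

definition cartesian ::
  "('e, 'x) monoid_scheme \<Rightarrow> ('m, 'y) monoid_scheme \<Rightarrow> ('e \<Rightarrow> 'm) \<Rightarrow> 'e \<Rightarrow> bool"
  where "cartesian E M \<sigma> x \<longleftrightarrow>
    x \<in> carrier E \<and>
    (\<forall>z \<in> carrier E. \<forall>v \<in> carrier M. \<sigma> z = \<sigma> x \<otimes>\<^bsub>M\<^esub> v \<longrightarrow>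
      (\<exists>y \<in> carrier E. z = x \<otimes>\<^bsub>E\<^esub> y \<and> \<sigma> y = v)) \<and>
    (\<forall>y1 \<in> carrier E. \<forall>y2 \<in> carrier E.
      x \<otimes>\<^bsub>E\<^esub> y1 = x \<otimes>\<^bsub>E\<^esub> y2 \<and> \<sigma> y1 = \<sigma> y2 \<longrightarrow> y1 = y2)"

locale fibration = monoid_homomorphism +
  assumes cartesian_lift:
    "m \<in> carrier M \<Longrightarrow> \<exists>x \<in> carrier E. \<sigma> x = m \<and> cartesian E M \<sigma> x"

end

theory Submission
  imports Defs
begin

text \<open>
  Write \<open>t = \<gamma> m n \<otimes> \<phi> n u\<close>, so that \<open>(m, u)(n, b) = (m n, t b)\<close>. Once the base component
  \<open>n\<close> is prescribed, left multiplication by \<open>(m, u)\<close> is left multiplication by \<open>t\<close> on the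
  fibre \<open>A\<close>. If \<open>u\<close> is invertible then so is \<open>\<phi> n u\<close>, because \<open>\<phi> n\<close> preserves products
  and the unit; for a pseudo action \<open>\<gamma> m n\<close> is invertible as well, hence so is \<open>t\<close>.
  Solving \<open>t b = c\<close> by \<open>b = t\<^sup>-\<^sup>1 c\<close> gives the lifting condition, and cancelling \<open>t\<close> gives
  uniqueness. Thus every \<open>(m, u)\<close> with \<open>u\<close> invertible is cartesian
  (\<open>cartesian_Groth_of_unit\<close>), and \<open>(m, \<one>)\<close> is a cartesian element above \<open>m\<close>.

  The total monoid is associative because of the cocycle identity together with the
  compatibility of \<open>\<gamma>\<close> with \<open>\<phi>\<close> (\<open>Groth_fibre_assoc\<close>); its projection to \<open>M\<close> is a
  homomorphism by construction.
\<close>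

lemma carrier_Groth: "carrier (Groth M A \<phi> \<gamma>) = carrier M \<times> carrier A"
  by (simp add: Groth_def)

lemma mult_Groth:
  "(m, a) \<otimes>\<^bsub>Groth M A \<phi> \<gamma>\<^esub> (n, b)
    = (m \<otimes>\<^bsub>M\<^esub> n, \<gamma> m n \<otimes>\<^bsub>A\<^esub> \<phi> n a \<otimes>\<^bsub>A\<^esub> b)"
  by (simp add: Groth_def)

lemma one_Groth: "\<one>\<^bsub>Groth M A \<phi> \<gamma>\<^esub> = (\<one>\<^bsub>M\<^esub>, \<one>\<^bsub>A\<^esub>)"
  by (simp add: Groth_def)

context lax_action
begin

text \<open>
  Associativity in the fibre component combines the cocycle identity, which trades
  \<open>\<gamma> (m n) k\<close> for \<open>\<gamma> m (n k)\<close>, with the law that lets \<open>\<gamma> n k\<close> pass the iterated action.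
\<close>

lemma Groth_fibre_assoc:
  assumes m: "m \<in> carrier M" and n: "n \<in> carrier M" and k: "k \<in> carrier M"
    and a: "a \<in> carrier A" and b: "b \<in> carrier A" and c: "c \<in> carrier A"
  shows "\<gamma> (m \<otimes>\<^bsub>M\<^esub> n) k \<otimes>\<^bsub>A\<^esub> \<phi> k (\<gamma> m n \<otimes>\<^bsub>A\<^esub> \<phi> n a \<otimes>\<^bsub>A\<^esub> b) \<otimes>\<^bsub>A\<^esub> c
    = \<gamma> m (n \<otimes>\<^bsub>M\<^esub> k) \<otimes>\<^bsub>A\<^esub> \<phi> (n \<otimes>\<^bsub>M\<^esub> k) a
        \<otimes>\<^bsub>A\<^esub> (\<gamma> n k \<otimes>\<^bsub>A\<^esub> \<phi> k b \<otimes>\<^bsub>A\<^esub> c)"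
proof -
  note cl = m n k a b c phi_closed gamma_closed M.m_closed A.m_closed
  have "\<gamma> (m \<otimes>\<^bsub>M\<^esub> n) k \<otimes>\<^bsub>A\<^esub> \<phi> k (\<gamma> m n \<otimes>\<^bsub>A\<^esub> \<phi> n a \<otimes>\<^bsub>A\<^esub> b) \<otimes>\<^bsub>A\<^esub> c
      = (\<gamma> (m \<otimes>\<^bsub>M\<^esub> n) k \<otimes>\<^bsub>A\<^esub> \<phi> k (\<gamma> m n))
          \<otimes>\<^bsub>A\<^esub> (\<phi> k (\<phi> n a) \<otimes>\<^bsub>A\<^esub> (\<phi> k b \<otimes>\<^bsub>A\<^esub> c))"
    by (simp add: cl phi_mult A.m_assoc)
  also have "\<dots> = \<gamma> m (n \<otimes>\<^bsub>M\<^esub> k)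
      \<otimes>\<^bsub>A\<^esub> ((\<gamma> n k \<otimes>\<^bsub>A\<^esub> \<phi> k (\<phi> n a)) \<otimes>\<^bsub>A\<^esub> (\<phi> k b \<otimes>\<^bsub>A\<^esub> c))"
    by (simp add: cl gamma_cocycle A.m_assoc)
  also have "\<dots> = \<gamma> m (n \<otimes>\<^bsub>M\<^esub> k)
      \<otimes>\<^bsub>A\<^esub> ((\<phi> (n \<otimes>\<^bsub>M\<^esub> k) a \<otimes>\<^bsub>A\<^esub> \<gamma> n k) \<otimes>\<^bsub>A\<^esub> (\<phi> k b \<otimes>\<^bsub>A\<^esub> c))"
    by (simp add: cl gamma_phi)
  also have "\<dots> = \<gamma> m (n \<otimes>\<^bsub>M\<^esub> k) \<otimes>\<^bsub>A\<^esub> \<phi> (n \<otimes>\<^bsub>M\<^esub> k) a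
      \<otimes>\<^bsub>A\<^esub> (\<gamma> n k \<otimes>\<^bsub>A\<^esub> \<phi> k b \<otimes>\<^bsub>A\<^esub> c)"
    by (simp add: cl A.m_assoc)
  finally show ?thesis .
qed

lemma monoid_Groth: "monoid (Groth M A \<phi> \<gamma>)"
  by (rule monoidI)
    (auto simp: carrier_Groth mult_Groth one_Groth M.m_assoc Groth_fibre_assoc
      phi_closed gamma_closed phi_one_left phi_one gamma_one_left gamma_one_right)

lemma monoid_homomorphism_Groth_projection:
  "monoid_homomorphism (Groth M A \<phi> \<gamma>) M (\<lambda>(m, a). m)"
  by (intro monoid_homomorphism.intro monoid_homomorphism_axioms.intro
      monoid_Groth M.monoid_axioms)
    (auto simp: hom_def carrier_Groth mult_Groth one_Groth)

lemma phi_Units: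
  assumes m: "m \<in> carrier M" and u: "u \<in> Units A"
  shows "\<phi> m u \<in> Units A"
proof -
  obtain v where v: "v \<in> carrier A" "v \<otimes>\<^bsub>A\<^esub> u = \<one>\<^bsub>A\<^esub>" "u \<otimes>\<^bsub>A\<^esub> v = \<one>\<^bsub>A\<^esub>"
    and uc: "u \<in> carrier A"
    using u by (auto simp: Units_def)
  have "\<phi> m v \<otimes>\<^bsub>A\<^esub> \<phi> m u = \<one>\<^bsub>A\<^esub>" "\<phi> m u \<otimes>\<^bsub>A\<^esub> \<phi> m v = \<one>\<^bsub>A\<^esub>"
    using m uc v by (simp_all add: phi_mult [symmetric] phi_one)
  with m uc v(1) show ?thesis
    by (auto simp: Units_def phi_closed)
qed

end

context pseudo_action
begin

text \<open>
  Both conditions on a cartesian element concern the equation \<open>t b = c\<close> in \<open>A\<close> with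
  \<open>t = \<gamma> m n \<otimes> \<phi> n u\<close>, and invertibility of \<open>t\<close> makes it uniquely solvable for \<open>b\<close>.
\<close>

lemma cartesian_Groth_of_unit:
  assumes m: "m \<in> carrier M" and u: "u \<in> Units A"
  shows "cartesian (Groth M A \<phi> \<gamma>) M (\<lambda>(m, a). m) (m, u)"
proof -
  have t: "\<gamma> m n \<otimes>\<^bsub>A\<^esub> \<phi> n u \<in> Units A" if "n \<in> carrier M" for n
    using that m u by (intro A.Units_m_closed gamma_Units phi_Units)
  have lift: "\<exists>b \<in> carrier A. c = \<gamma> m n \<otimes>\<^bsub>A\<^esub> \<phi> n u \<otimes>\<^bsub>A\<^esub> b"
    if n: "n \<in> carrier M" and c: "c \<in> carrier A" for n c
  proof
    let ?t = "\<gamma> m n \<otimes>\<^bsub>A\<^esub> \<phi> n u"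
    show "inv\<^bsub>A\<^esub> ?t \<otimes>\<^bsub>A\<^esub> c \<in> carrier A"
      using t [OF n] c by simp
    show "c = ?t \<otimes>\<^bsub>A\<^esub> (inv\<^bsub>A\<^esub> ?t \<otimes>\<^bsub>A\<^esub> c)"
      using t [OF n] c
      by (simp only: A.m_assoc [symmetric] A.Units_closed A.Units_inv_closed
          A.Units_r_inv A.l_one)
  qed
  have cancel: "b = b'"
    if "n \<in> carrier M" "b \<in> carrier A" "b' \<in> carrier A"
      and "\<gamma> m n \<otimes>\<^bsub>A\<^esub> \<phi> n u \<otimes>\<^bsub>A\<^esub> b = \<gamma> m n \<otimes>\<^bsub>A\<^esub> \<phi> n u \<otimes>\<^bsub>A\<^esub> b'" for n b b'
    using that t A.Units_l_cancel by blast
  show ?thesis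
    using m u lift cancel
    by (fastforce simp: cartesian_def carrier_Groth mult_Groth)
qed

end

theorem corollary4p3:
  fixes M :: "('m, 'x) monoid_scheme"
    and A :: "('a, 'y) monoid_scheme"
    and \<phi> :: "'m \<Rightarrow> 'a \<Rightarrow> 'a"
    and \<gamma> :: "'m \<Rightarrow> 'm \<Rightarrow> 'a"
  assumes "pseudo_action M A \<phi> \<gamma>"
  shows "fibration (Groth M A \<phi> \<gamma>) M (\<lambda>(m, a). m)"
proof -
  interpret pseudo_action M A \<phi> \<gamma> by (rule assms)
  show ?thesis
  proof (intro fibration.intro fibration_axioms.intro monoid_homomorphism_Groth_projection)
    fix m assume m: "m \<in> carrier M"
    show "\<exists>x \<in> carrier (Groth M A \<phi> \<gamma>). (case x of (m, a) \<Rightarrow> m) = m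
        \<and> cartesian (Groth M A \<phi> \<gamma>) M (\<lambda>(m, a). m) x"
      using m cartesian_Groth_of_unit [OF m A.Units_one_closed]
      by (intro bexI [where x = "(m, \<one>\<^bsub>A\<^esub>)"]) (simp_all add: carrier_Groth)
  qed
qed

end
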